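(* Let $h_1,h_2,l_1,l_2,\alpha_1,\alpha_2\in\mathbb{C}$, $t_1,t_2\in\mathbb{C}\setminus\{0\}$, and put $\lambda=(h_1+h_2-l_1-l_2-\alpha_1-\alpha_2+1)/2$. Consider the $q$-difference equation (variant of the $q$-hypergeometric equation of degree two) $$(x-q^{h_1+1/2}t_1)(x-q^{h_2+1/2}t_2)\,g(x/q)+q^{\alpha_1+\alpha_2}(x-q^{l_1-1/2}t_1)(x-q^{l_2-1/2}t_2)\,g(qx)-\big[(q^{\alpha_1}+q^{\alpha_2})x^2+Ex+p(q^{1/2}+q^{-1/2})t_1t_2\big]g(x)=0,$$ where $p=q^{(h_1+h_2+l_1+l_2+\alpha_1+\alpha_2)/2}$ and $E=-p\{(q^{-h_2}+q^{-l_2})t_1+(q^{-h_1}+q^{-l_1})t_2\}$. Let $(i,i')=(1,2)$ or $(2,1)$. (i) The function $$g(x)=x^{\lambda}\sum_{n=0}^{\infty}\frac{(q^{\lambda+\alpha_1};q)_n(q^{\lambda+\alpha_2};q)_n}{(q^{h_i-l_i+1};q)_n(q^{h_i-l_{i'}+1}t_i/t_{i'};q)_n(q;q)_n}\Big(\frac{q^{h_i+1/2}t_i}{x};q\Big)_n\Big(\frac{x}{q^{h_{i'}-1/2}t_{i'}}\Big)^n$$ $$\Big(=x^{\lambda}\,{}_3\phi_2\Big(q^{\lambda+\alpha_1},q^{\lambda+\alpha_2},\frac{q^{h_i+1/2}t_i}{x};q^{h_i-l_i+1},q^{h_i-l_{i'}+1}t_i/t_{i'};q,\frac{x}{q^{h_{i'}-1/2}t_{i'}}\Big)\Big)$$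 is a formal solution of this equation. (ii) The function $$g(x)=x^{-\alpha_1}\sum_{n=0}^{\infty}c_n\frac{(q^{\lambda+\alpha_1};q)_n}{(q^{1+h_{i'}-l_i}t_{i'}/t_i;q)_n}\Big(\frac{x}{q^{l_i-1/2}t_i};q\Big)_n\Big(\frac{q^{-\lambda-\alpha_1+h_{i'}+1/2}t_{i'}}{x}\Big)^n,$$ $$c_n=\sum_{k=0}^n q^{-nk+k^2/2}\frac{(q^{\lambda+\alpha_1-h_{i'}+l_{i'}};q)_k}{(q^{h_i-l_i+1};q)_k(q;q)_{n-k}(q;q)_k}\Big(-\frac{q^{-\lambda-\alpha_1+h_i+1/2}t_i}{q^{l_{i'}}t_{i'}}\Big)^k$$ is a formal solution of this equation.
   Context: Conventions: $q\in\mathbb{C}\setminus\{0\}$ is not a root of unity, with a fixed choice of $\log q$, and $q^{a}=\exp(a\log q)$. $(\lambda;q)_n=\prod_{j=0}^{n-1}(1-\lambda q^j)$. The basic hypergeometric series is ${}_r\phi_s(a_1,\dots,a_r;b_1,\dots,b_s;q,z)=\sum_{n\ge0}\frac{(a_1;q)_n\cdots(a_r;q)_n}{(b_1;q)_n\cdots(b_s;q)_n(q;q)_n}\big[(-1)^nq^{n(n-1)/2}\big]^{1+s-r}z^n$. Parameters are assumed such that no denominator factor in the displayed series vanishes. Formal solutions: convergence is not considered. For $\mu\in\mathbb{C}$, $x^\mu$ is a symbol with $(q^{\pm1}x)^\mu=q^{\pm\mu}x^\mu$. Each series has the form $x^\mu\sum_{n\ge0}a_n\varphi_n(x)$, where $a_n$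 does not depend on $x$ and $\varphi_n$ (the $x$-dependent part of the $n$-th term) is a polynomial of degree $n$ in $x$ or a polynomial of degree $n$ in $1/x$ (here $\varphi_n=(q^{h_i+1/2}t_i/x;q)_n\,x^n$ in (i) and $\varphi_n=(x/(q^{l_i-1/2}t_i);q)_n\,x^{-n}$ in (ii)). It is a formal solution if, substituting termwise into the left-hand side, dividing by $x^\mu$ (and also by $x^2$ when the $\varphi_n$ are polynomials in $1/x$), and expanding each resulting term in the basis $(\varphi_m)_{m\ge0}$, the total coefficient of every $\varphi_m$ (a finite sum) is zero. If the series terminates this means it is an exact solution. *)

theory Defs
  imports Complex_Main "HOL-Computational_Algebra.Polynomial"
begin

(* lq is the fixed choice of log q. *)
definition qpow :: "complex \<Rightarrow> complex \<Rightarrow> complex" where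
  "qpow lq a = exp (a * lq)"

definition qpoch :: "complex \<Rightarrow> complex \<Rightarrow> nat \<Rightarrow> complex" where
  "qpoch a q n = (\<Prod>j<n. 1 - a * q ^ j)"

(* The n-th summand of the basic hypergeometric series with upper parameters as and
   lower parameters bs. *)
definition bhs_summand ::
  "complex list \<Rightarrow> complex list \<Rightarrow> complex \<Rightarrow> complex \<Rightarrow> nat \<Rightarrow> complex" where
  "bhs_summand as bs q z n =
     (\<Prod>a\<leftarrow>as. qpoch a q n) / ((\<Prod>b\<leftarrow>bs. qpoch b q n) * qpoch q q n)
     * ((- 1) ^ n * q ^ (n * (n - 1) div 2)) powi (1 + int (length bs) - int (length as))
     * z ^ n"

(* Parameters h, l, t, \<alpha> are used at the indices 1 and 2 only. *)
definition lam :: "(nat \<Rightarrow> complex) \<Rightarrow> (nat \<Rightarrow> complex) \<Rightarrow> (nat \<Rightarrow> complex) \<Rightarrow> complex" where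
  "lam h l \<alpha> = (h 1 + h 2 - l 1 - l 2 - \<alpha> 1 - \<alpha> 2 + 1) / 2"

(* The left-hand side of the variant of the q-hypergeometric equation of degree two at the
   point x, where gm, gp, g0 stand for g(x/q), g(qx), g(x). *)
definition variant_lhs ::
  "complex \<Rightarrow> (nat \<Rightarrow> complex) \<Rightarrow> (nat \<Rightarrow> complex) \<Rightarrow> (nat \<Rightarrow> complex) \<Rightarrow> (nat \<Rightarrow> complex) \<Rightarrow>
   complex \<Rightarrow> complex \<Rightarrow> complex \<Rightarrow> complex \<Rightarrow> complex" where
  "variant_lhs lq h l \<alpha> t x gm gp g0 =
     (let p = qpow lq ((h 1 + h 2 + l 1 + l 2 + \<alpha> 1 + \<alpha> 2) / 2);
          E = - p * ((qpow lq (- h 2) + qpow lq (- l 2)) * t 1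
                   + (qpow lq (- h 1) + qpow lq (- l 1)) * t 2)
      in (x - qpow lq (h 1 + 1/2) * t 1) * (x - qpow lq (h 2 + 1/2) * t 2) * gm
         + qpow lq (\<alpha> 1 + \<alpha> 2)
           * (x - qpow lq (l 1 - 1/2) * t 1) * (x - qpow lq (l 2 - 1/2) * t 2) * gp
         - ((qpow lq (\<alpha> 1) + qpow lq (\<alpha> 2)) * x ^ 2 + E * x
            + p * (qpow lq (1/2) + qpow lq (- 1/2)) * t 1 * t 2) * g0)"

(* The value at x of x^(-\<mu>) times the left-hand side of a q-difference equation L, evaluated
   at x^\<mu> f(x); here x^\<mu> is only a symbol with (x/q)^\<mu> = q^(-\<mu>) x^\<mu> and (qx)^\<mu> = q^\<mu> x^\<mu>.
   As in variant_lhs, the last three arguments of L are g(x/q), g(qx), g(x). *)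
definition reduced_lhs ::
  "complex \<Rightarrow> (complex \<Rightarrow> complex \<Rightarrow> complex \<Rightarrow> complex \<Rightarrow> complex) \<Rightarrow> complex \<Rightarrow>
   (complex \<Rightarrow> complex) \<Rightarrow> complex \<Rightarrow> complex" where
  "reduced_lhs lq L \<mu> f x =
     L x (qpow lq (- \<mu>) * f (x / exp lq)) (qpow lq \<mu> * f (exp lq * x)) (f x)"

definition poly_basis_x :: "(nat \<Rightarrow> complex \<Rightarrow> complex) \<Rightarrow> bool" where
  "poly_basis_x \<phi> \<longleftrightarrow>
     (\<forall>n. \<exists>P :: complex poly. P \<noteq> 0 \<and> degree P = n \<and> (\<forall>x. x \<noteq> 0 \<longrightarrow> \<phi> n x = poly P x))"

definition poly_basis_inverse_x :: "(nat \<Rightarrow> complex \<Rightarrow> complex) \<Rightarrow> bool" where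
  "poly_basis_inverse_x \<phi> \<longleftrightarrow>
     (\<forall>n. \<exists>P :: complex poly. P \<noteq> 0 \<and> degree P = n \<and> (\<forall>x. x \<noteq> 0 \<longrightarrow> \<phi> n x = poly P (1 / x)))"

(* Every T n is a finite linear combination of the \<phi> m, with coefficients d n m, and for every m
   the total coefficient of \<phi> m in the formal sum of all T n is a finite sum equal to zero.
   The coefficients d n m are unique whenever the \<phi> m are linearly independent, in particular
   under poly_basis_x or poly_basis_inverse_x. *)
definition vanishes_in_basis ::
  "(nat \<Rightarrow> complex \<Rightarrow> complex) \<Rightarrow> (nat \<Rightarrow> complex \<Rightarrow> complex) \<Rightarrow> bool" where
  "vanishes_in_basis \<phi> T \<longleftrightarrow>
     (\<exists>d :: nat \<Rightarrow> nat \<Rightarrow> complex.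
        (\<forall>n. finite {m. d n m \<noteq> 0} \<and>
             (\<forall>x. x \<noteq> 0 \<longrightarrow> T n x = (\<Sum>m | d n m \<noteq> 0. d n m * \<phi> m x))) \<and>
        (\<forall>m. finite {n. d n m \<noteq> 0} \<and> (\<Sum>n | d n m \<noteq> 0. d n m) = 0))"

(* x^\<mu> times the sum of the u n, where u n is a constant multiple of \<phi> n, is a formal solution of
   L = 0. *)
definition formal_solution ::
  "complex \<Rightarrow> (complex \<Rightarrow> complex \<Rightarrow> complex \<Rightarrow> complex \<Rightarrow> complex) \<Rightarrow> complex \<Rightarrow>
   (nat \<Rightarrow> complex \<Rightarrow> complex) \<Rightarrow> (nat \<Rightarrow> complex \<Rightarrow> complex) \<Rightarrow> bool" where
  "formal_solution lq L \<mu> \<phi> u \<longleftrightarrow>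
     (\<exists>a :: nat \<Rightarrow> complex. \<forall>n x. x \<noteq> 0 \<longrightarrow> u n x = a n * \<phi> n x) \<and>
     (poly_basis_x \<phi> \<and>
        vanishes_in_basis \<phi> (\<lambda>n x. reduced_lhs lq L \<mu> (u n) x) \<or>
      poly_basis_inverse_x \<phi> \<and>
        vanishes_in_basis \<phi> (\<lambda>n x. reduced_lhs lq L \<mu> (u n) x / x ^ 2))"

definition c_coeff ::
  "complex \<Rightarrow> (nat \<Rightarrow> complex) \<Rightarrow> (nat \<Rightarrow> complex) \<Rightarrow> (nat \<Rightarrow> complex) \<Rightarrow> (nat \<Rightarrow> complex) \<Rightarrow>
   nat \<Rightarrow> nat \<Rightarrow> nat \<Rightarrow> complex" where
  "c_coeff lq h l \<alpha> t i i' n =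
     (let q = exp lq; \<Lambda> = lam h l \<alpha> in
      \<Sum>k\<le>n. qpow lq (- of_nat n * of_nat k + of_nat k ^ 2 / 2)
        * (qpoch (qpow lq (\<Lambda> + \<alpha> 1 - h i' + l i')) q k
           / (qpoch (qpow lq (h i - l i + 1)) q k * qpoch q q (n - k) * qpoch q q k))
        * (- (qpow lq (- \<Lambda> - \<alpha> 1 + h i + 1/2) * t i / (qpow lq (l i') * t i'))) ^ k)"

end

(* Let a, c and b, b' be the zeros of the two quadratic coefficients, L = q^lambda, A = q^(alpha 1) and
   B = q^(alpha 2); the only relation between them is a c = L^2 A B q b b'.  In the Newton basis
   phi_n = prod_(j<n) (x - a q^j) of (i), the left-hand side for x^lambda a_n phi_n is x^lambda times
   (x^2/L) (v_n phi_n - v_(n-1) phi_(n-1)), where v_n = a_n (1 - L A q^n) (1 - L B q^n) / q^n, so the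
   sum over n telescopes.  In the Newton basis of (ii), in the variable 1/x, the left-hand side for
   phi_n, divided by x^2, is 1/x times a combination of phi_(n+1), phi_n and phi_(n-1); the total
   coefficients vanish because c_n satisfies a second order recurrence, which follows by telescoping
   the sum over k (creative telescoping). *)
theory Submission
  imports Defs
begin

section \<open>Newton polynomials with geometric nodes and q-shifted factorials\<close>

definition newton :: "complex \<Rightarrow> complex \<Rightarrow> nat \<Rightarrow> complex \<Rightarrow> complex" where
  "newton a q n y = (\<Prod>j<n. y - a * q ^ j)"

lemma newton_0 [simp]: "newton a q 0 y = 1"
  by (simp add: newton_def)

lemma newton_Suc: "newton a q (Suc n) y = (y - a * q ^ n) * newton a q n y"
  by (simp add: newton_def mult.commute)

text \<open>The nodes form a geometric progression, so the dilation by q moves each node to the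
  preceding one: the node a / q enters and the last node leaves.\<close>

lemma newton_mult:
  assumes "q \<noteq> 0"
  shows "newton a q (Suc n) (q * y) = q ^ Suc n * (y - a / q) * newton a q n y"
proof (induction n)
  case 0
  show ?case using assms by (simp add: newton_def field_simps)
next
  case (Suc n)
  have "newton a q (Suc (Suc n)) (q * y) = (q * y - a * q ^ Suc n) * newton a q (Suc n) (q * y)"
    by (rule newton_Suc)
  also have "\<dots> = q * (y - a * q ^ n) * (q ^ Suc n * (y - a / q) * newton a q n y)"
    by (simp only: Suc) (simp add: algebra_simps)
  finally show ?case by (simp add: newton_Suc algebra_simps)
qed

text \<open>Dilation by 1/q moves each node to the next one, and the factor y - a restores the lost
  first node. In the equation this factor is supplied by the coefficient of g(x/q) in (i), and by
  that of g(qx), with y = 1/x, in (ii).\<close>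

lemma newton_div:
  assumes "q \<noteq> 0"
  shows "(y - a) * newton a q n (y / q) = newton a q (Suc n) y / q ^ n"
proof (induction n)
  case 0
  show ?case by (simp add: newton_def)
next
  case (Suc n)
  have "(y - a) * newton a q (Suc n) (y / q) = (y / q - a * q ^ n) * ((y - a) * newton a q n (y / q))"
    by (simp add: newton_Suc)
  also have "\<dots> = (y / q - a * q ^ n) * (newton a q (Suc n) y / q ^ n)"
    by (simp only: Suc)
  also have "\<dots> = newton a q (Suc (Suc n)) y / q ^ Suc n"
    using assms by (simp add: newton_Suc[of a q "Suc n"] field_simps)
  finally show ?case .
qed

lemma qpoch_0 [simp]: "qpoch a q 0 = 1"
  by (simp add: qpoch_def)

lemma qpoch_Suc: "qpoch a q (Suc n) = qpoch a q n * (1 - a * q ^ n)"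
  by (simp add: qpoch_def)

lemma qpoch_eq_newton: "x \<noteq> 0 \<Longrightarrow> qpoch (a / x) q n * x ^ n = newton a q n x"
  by (induction n) (simp_all add: qpoch_Suc newton_Suc field_simps)

lemma qpoch_eq_newton_inverse:
  "x \<noteq> 0 \<Longrightarrow> b \<noteq> 0 \<Longrightarrow> qpoch (x / b) q n / x ^ n = newton (1 / b) q n (1 / x)"
  by (induction n) (simp_all add: qpoch_Suc newton_Suc field_simps)

lemma newton_eq_poly:
  "\<exists>P :: complex poly. P \<noteq> 0 \<and> degree P = n \<and> (\<forall>y. newton a q n y = poly P y)"
proof -
  define P where "P = (\<Prod>j<n. [:- (a * q ^ j), 1:])"
  have "P \<noteq> 0" by (simp add: P_def)
  moreover have "degree P = n" by (simp add: P_def degree_prod_eq_sum_degree)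
  moreover have "newton a q n y = poly P y" for y
    by (simp add: P_def newton_def poly_prod)
  ultimately show ?thesis by blast
qed

section \<open>Formal vanishing of telescoping series\<close>

text \<open>\<open>R n\<close> is the partial sum of the \<open>T k\<close> up to n, and it involves
  only the basis functions from index n to n + N. Hence the coefficient of a fixed basis function in
  the partial sums becomes zero as soon as n exceeds its index.\<close>

lemma vanishes_in_basis_telescoping:
  assumes R: "\<And>n x. x \<noteq> 0 \<Longrightarrow> R n x = (\<Sum>j\<le>N. r n j * \<phi> (n + j) x)"
    and T0: "\<And>x. x \<noteq> 0 \<Longrightarrow> T 0 x = R 0 x"
    and TS: "\<And>n x. x \<noteq> 0 \<Longrightarrow> T (Suc n) x = R (Suc n) x - R n x"
  shows "vanishes_in_basis \<phi> T"
proof -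
  \<comment> \<open>\<open>C n m\<close> is the coefficient of \<open>\<phi> m\<close> in
    \<open>R n\<close>; its differences in n are the coefficients of \<open>T n\<close>.\<close>
  define C where "C n m = (if n \<le> m \<and> m \<le> n + N then r n (m - n) else 0)" for n m
  define d where "d n m = (case n of 0 \<Rightarrow> C 0 m | Suc k \<Rightarrow> C (Suc k) m - C k m)" for n m
  \<comment> \<open>The free bound M lets two consecutive \<open>R\<close> be expanded over the same
    index range and subtracted.\<close>
  have RC: "R n x = (\<Sum>m\<le>M. C n m * \<phi> m x)" if "x \<noteq> 0" "n + N \<le> M" for n x M
  proof -
    have "(\<Sum>m\<le>M. C n m * \<phi> m x) = (\<Sum>m\<in>{n..n+N}. C n m * \<phi> m x)"
      by (rule sum.mono_neutral_right) (use that in \<open>auto simp: C_def\<close>)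
    also have "\<dots> = (\<Sum>j\<le>N. r n j * \<phi> (n + j) x)"
      by (rule sum.reindex_bij_witness[of _ "\<lambda>j. n + j" "\<lambda>m. m - n"]) (auto simp: C_def)
    finally show ?thesis using R that by simp
  qed
  have row: "{m. d n m \<noteq> 0} \<subseteq> {..n + N}" for n
    by (cases n) (auto simp: d_def C_def split: if_splits)
  have "n \<le> Suc m" if "d n m \<noteq> 0" for n m
    using that by (cases n) (auto simp: d_def C_def split: if_splits)
  then have col: "{n. d n m \<noteq> 0} \<subseteq> {..Suc m}" for m by auto
  have "T n x = (\<Sum>m | d n m \<noteq> 0. d n m * \<phi> m x)" if "x \<noteq> 0" for n x
  proof -
    have "(\<Sum>m | d n m \<noteq> 0. d n m * \<phi> m x) = (\<Sum>m\<le>n + N. d n m * \<phi> m x)"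
      by (rule sum.mono_neutral_left) (use row[of n] in auto)
    also have "\<dots> = T n x"
    proof (cases n)
      case 0
      then show ?thesis using T0 RC[of x 0 N] that by (simp add: d_def)
    next
      case (Suc k)
      then show ?thesis
        using TS RC[of x n "n + N"] RC[of x k "n + N"] that
        by (simp add: d_def left_diff_distrib sum_subtractf)
    qed
    finally show ?thesis by simp
  qed
  moreover have "(\<Sum>n | d n m \<noteq> 0. d n m) = 0" for m
  proof -
    have "(\<Sum>n | d n m \<noteq> 0. d n m) = (\<Sum>n\<le>Suc m. d n m)"
      by (rule sum.mono_neutral_left) (use col[of m] in auto)
    \<comment> \<open>Used at k = m + 1, just beyond m, where \<open>C k m\<close> is zero.\<close>
    also have "(\<Sum>n\<le>k. d n m) = C k m" for k
      by (induction k) (simp_all add: d_def)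
    finally show ?thesis by (simp add: C_def)
  qed
  ultimately show ?thesis
    unfolding vanishes_in_basis_def
    using finite_subset[OF row] finite_subset[OF col] by blast
qed

(* The left-hand side of the equation with E and the constant term rewritten through a, c, b, b'. *)
definition factored_lhs ::
  "complex \<Rightarrow> complex \<Rightarrow> complex \<Rightarrow> complex \<Rightarrow> complex \<Rightarrow> complex \<Rightarrow> complex \<Rightarrow>
   complex \<Rightarrow> complex \<Rightarrow> complex \<Rightarrow> complex \<Rightarrow> complex" where
  "factored_lhs A B \<Lambda> a c b b' x gm gp g0 =
     (x - a) * (x - c) * gm + A * B * (x - b) * (x - b') * gp
     - ((A + B) * x ^ 2 - ((a + c) / \<Lambda> + \<Lambda> * A * B * (b + b')) * x
        + (a * c / \<Lambda> + \<Lambda> * A * B * b * b')) * g0"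

section \<open>The equation on Newton polynomials, and the recurrence for c_n\<close>

lemma factored_lhs_newton_0:
  assumes "\<Lambda> \<noteq> 0"
  shows "factored_lhs A B \<Lambda> a c b b' x (1 / \<Lambda>) \<Lambda> 1
      = x ^ 2 / \<Lambda> * ((1 - \<Lambda> * A) * (1 - \<Lambda> * B))"
  using assms unfolding factored_lhs_def
  by (simp add: field_simps power2_eq_square)

text \<open>By the shift rules \<open>newton a q n x\<close> is a common factor of all three terms,
  with a cubic cofactor in x. Its constant term cancels, and its linear coefficient is 1 - q^(n+1)
  times a c / (q \<Lambda>) - \<Lambda> A B b b', which is zero by \<open>rel\<close>; so x^2 splits
  off. At the node x = a q^n only the g(qx) term survives, which gives the coefficient of
  \<open>newton a q n x\<close>.\<close>

lemma factored_lhs_newton_Suc: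
  assumes nz: "q \<noteq> 0" "\<Lambda> \<noteq> 0" "a \<noteq> 0" "b \<noteq> 0" "b' \<noteq> 0"
    and rel: "a * c = \<Lambda> ^ 2 * A * B * q * b * b'"
  shows "factored_lhs A B \<Lambda> a c b b' x
           (newton a q (Suc n) (x / q) / \<Lambda>) (\<Lambda> * newton a q (Suc n) (q * x)) (newton a q (Suc n) x)
      = x ^ 2 / \<Lambda> * ((1 - \<Lambda> * A * q ^ Suc n) * (1 - \<Lambda> * B * q ^ Suc n) / q ^ Suc n * newton a q (Suc n) x
          - c / q ^ Suc n * (1 - q ^ Suc n) * (1 - a / b * q ^ n) * (1 - a / b' * q ^ n) * newton a q n x)"
proof -
  define F Q where "F = newton a q n x" and "Q = q ^ n"
  have Q: "Q \<noteq> 0" using nz by (simp add: Q_def)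
  have F1: "newton a q (Suc n) x = (x - a * Q) * F"
    by (simp add: newton_Suc F_def Q_def)
  have F2: "newton a q (Suc n) (q * x) = q * Q * (x - a / q) * F"
    using newton_mult[OF nz(1), of a n x] by (simp add: F_def Q_def)
  have F3: "(x - a) * newton a q (Suc n) (x / q) = (x - a * q * Q) * (x - a * Q) * F / (q * Q)"
    using newton_div[OF nz(1), of x a "Suc n"] by (simp add: F_def Q_def newton_Suc)
  have c: "c = \<Lambda> ^ 2 * A * B * q * b * b' / a" using rel nz by (simp add: field_simps)
  have "factored_lhs A B \<Lambda> a c b b' x
           (newton a q (Suc n) (x / q) / \<Lambda>) (\<Lambda> * newton a q (Suc n) (q * x)) (newton a q (Suc n) x)
     = (x - c) * ((x - a * q * Q) * (x - a * Q) / (q * Q)) * F / \<Lambda>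
       + A * B * (x - b) * (x - b') * (\<Lambda> * (q * Q * (x - a / q) * F))
       - ((A + B) * x ^ 2 - ((a + c) / \<Lambda> + \<Lambda> * A * B * (b + b')) * x
        + (a * c / \<Lambda> + \<Lambda> * A * B * b * b')) * ((x - a * Q) * F)"
    using F3 unfolding factored_lhs_def F1 F2
    by (simp add: mult.assoc[symmetric] mult.commute[of "x - a" "x - c"])
       (simp add: mult.assoc)
  also have "\<dots> = x ^ 2 / \<Lambda> * ((1 - \<Lambda> * A * (q * Q)) * (1 - \<Lambda> * B * (q * Q)) / (q * Q) * ((x - a * Q) * F)
          - c / (q * Q) * (1 - q * Q) * (1 - a / b * Q) * (1 - a / b' * Q) * F)"
    unfolding c using nz Q by (simp add: divide_simps power2_eq_square) algebra
  finally show ?thesis unfolding F1 by (simp add: F_def Q_def)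
qed

text \<open>For the exponent -\<alpha>_1 the shifts contribute A and 1/A, and the coefficient of x^2
  is A + B - (A + B) = 0. This is why a factor 1/x remains after division by x^2.\<close>

lemma factored_lhs_newton_inverse_0:
  assumes nz: "q \<noteq> 0" "\<Lambda> \<noteq> 0" "A \<noteq> 0" "b \<noteq> 0" "x \<noteq> 0"
    and rel: "a * c = \<Lambda> ^ 2 * A * B * q * b * b'"
  shows "factored_lhs A B \<Lambda> a c b b' x A (1 / A) 1 / x ^ 2
      = 1 / x * (B * b * b' * (1 - \<Lambda> * A) * (1 - \<Lambda> * A * q) * (1 / x - 1 / b)
           + (1 - \<Lambda> * A) * ((a + c) / \<Lambda> - B * b - \<Lambda> * A * B * b' * q))"
proof -
  have *: "factored_lhs A B \<Lambda> a c b b' x A (1 / A) 1 =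
     (1 - \<Lambda> * A) * ( x * (a + c) / \<Lambda> - B * (b + b') * x  + B * b * b') - a * c / \<Lambda> * (1 - \<Lambda> * A)"
    using nz unfolding factored_lhs_def by (simp add: field_simps power2_eq_square)
  show ?thesis unfolding * rel using nz
    by (simp add: divide_simps power2_eq_square) algebra
qed

text \<open>In y = 1/x the Newton polynomial of index n is again a common factor with a cubic
  cofactor. Only its constant term cancels, so a single y splits off, and the remaining quadratic
  needs three basis functions; hence a second order recurrence instead of a direct cancellation. At
  the node y = q^n / b only the g(x/q) term survives, which gives the last coefficient.\<close>

lemma factored_lhs_newton_inverse_Suc:
  assumes nz: "q \<noteq> 0" "\<Lambda> \<noteq> 0" "A \<noteq> 0" "b \<noteq> 0" "c \<noteq> 0" "x \<noteq> 0"
    and rel: "a * c = \<Lambda> ^ 2 * A * B * q * b * b'"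
  defines "\<phi> \<equiv> newton (1 / b) q"
  shows "factored_lhs A B \<Lambda> a c b b' x
           (A * \<phi> (Suc n) (q / x)) (\<phi> (Suc n) (1 / x / q) / A) (\<phi> (Suc n) (1 / x)) / x ^ 2
      = 1 / x * (B * b * b' * (1 - \<Lambda> * A * q ^ Suc n) * (1 - \<Lambda> * A * q ^ Suc (Suc n)) / q ^ Suc n * \<phi> (Suc (Suc n)) (1 / x)
           + (1 - \<Lambda> * A * q ^ Suc n) * ((a + c) / \<Lambda> - B * b / q ^ Suc n + \<Lambda> * A * B * b' * (1 - q ^ Suc n * (1 + q))) * \<phi> (Suc n) (1 / x)
           - A * (1 - a / b * q ^ n) * (1 - c / b * q ^ n) * (1 - q ^ Suc n) * \<phi> n (1 / x))"
proof -
  define y F Q where "y = 1 / x" and "F = \<phi> n y" and "Q = q ^ n"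
  have Q: "Q \<noteq> 0" using nz by (simp add: Q_def)
  have y: "x = 1 / y" "y \<noteq> 0" using nz by (simp_all add: y_def)
  have F1: "\<phi> (Suc n) (1 / x) = (y - Q / b) * F"
    by (simp add: newton_Suc F_def Q_def y_def \<phi>_def)
  have F4: "\<phi> (Suc (Suc n)) (1 / x) = (y - q * Q / b) * (y - Q / b) * F"
    by (simp add: newton_Suc F_def Q_def y_def \<phi>_def)
  have F2: "\<phi> (Suc n) (q / x) = q * Q * (y - 1 / b / q) * F"
    using newton_mult[OF nz(1), of "1 / b" n y] by (simp add: F_def Q_def y_def \<phi>_def)
  have F3: "(y - 1 / b) * \<phi> (Suc n) (1 / x / q) = (y - q * Q / b) * (y - Q / b) * F / (q * Q)"
    using newton_div[OF nz(1), of y "1 / b" "Suc n"]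
    by (simp add: F_def Q_def newton_Suc y_def \<phi>_def)
  have a: "a = \<Lambda> ^ 2 * A * B * q * b * b' / c" using rel nz by (simp add: field_simps)
  \<comment> \<open>The value at y / q enters only in the product with y - 1 / b, which
    \<open>F3\<close> evaluates.\<close>
  define G where "G = \<phi> (Suc n) (1 / x / q)"
  have "factored_lhs A B \<Lambda> a c b b' x
           (A * (q * Q * (y - 1 / b / q) * F)) (G / A) ((y - Q / b) * F) / x ^ 2
     = (1 - a * y) * (1 - c * y) * (A * (q * Q * (y - 1 / b / q) * F))
       - B * b * (1 - b' * y) * ((y - 1 / b) * G)
       - ((A + B) - ((a + c) / \<Lambda> + \<Lambda> * A * B * (b + b')) * y
        + (a * c / \<Lambda> + \<Lambda> * A * B * b * b') * y ^ 2) * ((y - Q / b) * F)"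
    using nz y(2) unfolding factored_lhs_def y(1)
    by (simp add: divide_simps power2_eq_square) algebra
  also have "\<dots> = y * (B * b * b' * (1 - \<Lambda> * A * (q * Q)) * (1 - \<Lambda> * A * (q * (q * Q))) / (q * Q) * ((y - q * Q / b) * (y - Q / b) * F)
           + (1 - \<Lambda> * A * (q * Q)) * ((a + c) / \<Lambda> - B * b / (q * Q) + \<Lambda> * A * B * b' * (1 - q * Q * (1 + q))) * ((y - Q / b) * F)
           - A * (1 - a / b * Q) * (1 - c / b * Q) * (1 - q * Q) * F)"
    unfolding F3[folded G_def] a using nz Q y(2)
    by (simp add: divide_simps power2_eq_square) algebra
  finally have "factored_lhs A B \<Lambda> a c b b' x
           (A * (q * Q * (y - 1 / b / q) * F)) (G / A) ((y - Q / b) * F) / x ^ 2 = \<dots>" .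
  then show ?thesis unfolding F1 F2 F4 G_def
    by (simp only: F_def Q_def y_def power_Suc)
qed

(* For P k = q^(k(k-1)/2) (v;q)_k (-W)^k / ((u;q)_k (q;q)_k) the sum C n is the coefficient c_n of (ii). *)
lemma convolution_recurrence:
  fixes q u v W :: complex and P :: "nat \<Rightarrow> complex"
  assumes q: "q \<noteq> 0" "\<forall>n>0. q ^ n \<noteq> 1"
    and P: "\<And>k. P (Suc k) * ((1 - u * q ^ k) * (1 - q ^ Suc k)) = - W * q ^ k * (1 - v * q ^ k) * P k"
  defines "C \<equiv> \<lambda>n. \<Sum>k\<le>n. P k / (q ^ (n * k) * qpoch q q (n - k))"
  shows "(1 - u * q ^ m) * (1 - q ^ Suc m) * C (Suc m)
    = (1 + v * W / q - W / q ^ Suc m + u / q * (1 - q ^ m - q ^ Suc m)) * C m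
      + (v * W / q ^ Suc m - u / q) * (if m = 0 then 0 else C (m - 1))"
proof -
  have qn: "q ^ Suc n \<noteq> 1" for n using q(2) by blast
  have pq: "qpoch q q n \<noteq> 0" for n
  proof (induction n)
    case (Suc n)
    then show ?case using qn[of n] by (simp add: qpoch_Suc)
  qed simp
  define Q where "Q = q ^ Suc m"
  have Q0: "Q \<noteq> 0" and Q1: "1 - Q / q ^ Suc m = 0" using q by (simp_all add: Q_def)
  \<comment> \<open>\<open>G\<close> is a common unit for the summands of C (m+1), C m and C (m-1).
    Relative to it they differ by factors depending on q^k, and these factors vanish exactly at the
    k beyond the shorter ranges, so all three sums can run to m + 1.\<close>
  define G where "G k = P k / (q ^ (m * k) * qpoch q q (Suc m - k))" for k
  have c1: "C (Suc m) = (\<Sum>k\<le>Suc m. 1 / q ^ k * G k)"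
    unfolding C_def G_def by (rule sum.cong) (simp_all add: power_add)
  have G1: "(1 - Q / q ^ k) * G k = P k / (q ^ (m * k) * qpoch q q (m - k))" if "k \<le> m" for k
  proof -
    have "Q / q ^ k = q * q ^ (m - k)" using that q by (simp add: Q_def power_diff)
    then show ?thesis using that qn[of "m - k"]
      by (simp add: G_def Suc_diff_le qpoch_Suc)
  qed
  have c0: "C m = (\<Sum>k\<le>Suc m. (1 - Q / q ^ k) * G k)"
    unfolding sum.atMost_Suc Q1 by (simp add: G1 C_def)
  \<comment> \<open>The value 0 for m = 0 fits the same formula: one of the two factors vanishes at
    k = 0, the other at k = 1.\<close>
  have cm: "(if m = 0 then 0 else C (m - 1))
      = (\<Sum>k\<le>Suc m. q ^ k * (1 - q ^ m / q ^ k) * (1 - Q / q ^ k) * G k)"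
  proof (cases m)
    case 0
    then show ?thesis using q by (simp add: Q_def)
  next
    case (Suc n)
    have "q ^ k * (1 - q ^ m / q ^ k) * (1 - Q / q ^ k) * G k = P k / (q ^ (n * k) * qpoch q q (n - k))"
      if "k \<le> n" for k
    proof -
      have "q ^ m / q ^ k = q * q ^ (n - k)" using that q by (simp add: Suc power_diff)
      then have "q ^ k * (1 - q ^ m / q ^ k) * (P k / (q ^ (m * k) * qpoch q q (m - k)))
          = P k / (q ^ (n * k) * qpoch q q (n - k))"
        using that qn[of "n - k"] q
        by (simp add: Suc Suc_diff_le qpoch_Suc power_add)
      then show ?thesis using G1[of k] that Suc by (simp add: mult.assoc)
    qed
    then show ?thesis using G1[of m] q Q1 Suc by (simp add: C_def del: power_Suc)
  qed
  (* Y is the certificate: X k * G k, the k-th summand of the recurrence, is Y (k + 1) - Y k for k <= m. *)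
  define Y where "Y k = - (1 / q ^ k) * (1 - u / q * q ^ k) * (1 - q ^ k) * G k" for k
  define X where "X k = (1 - u * q ^ m) * (1 - Q) * (1 / q ^ k)
      - (1 + v * W / q - W / Q + u / q * (1 - q ^ m - Q)) * (1 - Q / q ^ k)
      - (v * W / Q - u / q) * (q ^ k * (1 - q ^ m / q ^ k) * (1 - Q / q ^ k))" for k
  \<comment> \<open>\<open>Z k\<close> is Y (k + 1) with P (k + 1) replaced through its recurrence.
    Then \<open>XZ\<close> is a rational identity at a single k, with \<open>G k\<close> as a common
    factor.\<close>
  define Z where "Z k = W / Q * (1 - Q / q ^ k) * (1 - v * q ^ k) * G k" for k
  have Qm: "q ^ m = Q / q" using q by (simp add: Q_def)
  have XZ: "X k * G k = Z k - Y k" for k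
  proof -
    define K where "K = q ^ k"
    have "K \<noteq> 0" using q by (simp add: K_def)
    then show ?thesis
      using q(1) Q0 unfolding X_def Y_def Z_def Qm K_def[symmetric]
      by (simp add: divide_simps) algebra
  qed
  have ZY: "Z k = Y (Suc k)" if "k \<le> m" for k
  proof -
    define D where "D = q ^ (m * k) * qpoch q q (m - k)"
    have D: "D \<noteq> 0" using q pq by (simp add: D_def)
    have "Z k = W / Q * (1 - v * q ^ k) * ((1 - Q / q ^ k) * G k)"
      by (simp add: Z_def mult_ac)
    also have "\<dots> = W / Q * (1 - v * q ^ k) * P k / D"
      by (simp add: G1[OF that] D_def)
    also have "\<dots> = - (P (Suc k) * ((1 - u * q ^ k) * (1 - q ^ Suc k))) / (Q * q ^ k * D)"
      unfolding P using q Q0 D by (simp add: field_simps)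
    also have "\<dots> = Y (Suc k)"
      using that q D Q0 by (simp add: Y_def G_def D_def Q_def power_add field_simps)
    finally show ?thesis .
  qed
  have "(\<Sum>k\<le>Suc m. X k * G k) = (\<Sum>k\<le>Suc m. Z k) - (\<Sum>k\<le>Suc m. Y k)"
    by (simp only: XZ sum_subtractf)
  \<comment> \<open>No boundary terms remain: \<open>Z\<close> vanishes at k = m + 1 by its factor 1
    - Q / q^k, and \<open>Y\<close> vanishes at 0 by its factor 1 - q^k.\<close>
  also have "(\<Sum>k\<le>Suc m. Z k) = (\<Sum>k\<le>m. Y (Suc k))"
    using q ZY by (simp add: Z_def Q_def)
  also have "(\<Sum>k\<le>Suc m. Y k) = Y 0 + (\<Sum>k\<le>m. Y (Suc k))"
    by (rule sum.atMost_Suc_shift)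
  also have "Y 0 = 0" by (simp add: Y_def)
  finally have "(\<Sum>k\<le>Suc m. X k * G k) = 0" by simp
  also have "(\<Sum>k\<le>Suc m. X k * G k) = (1 - u * q ^ m) * (1 - Q) * C (Suc m)
      - (1 + v * W / q - W / Q + u / q * (1 - q ^ m - Q)) * C m
      - (v * W / Q - u / q) * (if m = 0 then 0 else C (m - 1))"
  proof -
    have "(x1 * p1 - x2 * p2 - x3 * p3) * g = x1 * (p1 * g) - x2 * (p2 * g) - x3 * (p3 * g)"
      for x1 x2 x3 p1 p2 p3 g :: complex
      by (simp add: algebra_simps)
    then show ?thesis
      unfolding c1 c0 cm sum_distrib_left sum_subtractf[symmetric] by (simp only: X_def)
  qed
  finally show ?thesis unfolding Q_def diff_diff_eq by (simp only: right_minus_eq)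
qed

section \<open>The two series in terms of the zeros a, c, b, b'\<close>

lemma factored_lhs_scale:
  "factored_lhs A B \<Lambda> a c b b' x (k * gm) (k * gp) (k * g0) = k * factored_lhs A B \<Lambda> a c b b' x gm gp g0"
  by (simp add: factored_lhs_def algebra_simps)

text \<open>The hypergeometric ratio s (n+1) / s n is exactly the one for which the lower basis term
  of the summand n + 1 cancels the upper one of the summand n.\<close>

lemma vanishes_in_newton_basis:
  fixes A B \<Lambda> a c b b' q :: complex
  assumes nz: "q \<noteq> 0" "\<Lambda> \<noteq> 0" "a \<noteq> 0" "b \<noteq> 0" "b' \<noteq> 0" "c \<noteq> 0"
    and q: "\<forall>n>0. q ^ n \<noteq> 1"
    and rel: "a * c = \<Lambda> ^ 2 * A * B * q * b * b'"
    and den: "\<And>n. qpoch (a / b) q n \<noteq> 0" "\<And>n. qpoch (a / b') q n \<noteq> 0"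
  defines "\<phi> \<equiv> newton a q"
  defines "s \<equiv> \<lambda>n. qpoch (\<Lambda> * A) q n * qpoch (\<Lambda> * B) q n
      / (qpoch (a / b) q n * qpoch (a / b') q n * qpoch q q n) * (q / c) ^ n"
  shows "vanishes_in_basis \<phi> (\<lambda>n x. s n *
           factored_lhs A B \<Lambda> a c b b' x (\<phi> n (x / q) / \<Lambda>) (\<Lambda> * \<phi> n (q * x)) (\<phi> n x))"
proof -
  define e where "e n = (1 - \<Lambda> * A * q ^ n) * (1 - \<Lambda> * B * q ^ n) / q ^ n" for n
  define R where "R n x = x ^ 2 / \<Lambda> * (s n * e n * \<phi> n x)" for n x
  \<comment> \<open>Coefficients of x^2 \<open>\<phi> n\<close>, from using x
    \<open>\<phi> n\<close> = \<open>\<phi> (n + 1)\<close> + a q^n \<open>\<phi> n\<close>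
    twice.\<close>
  define r where "r n j = s n * e n / \<Lambda> *
     (if j = 0 then (a * q ^ n) ^ 2 else if j = 1 then a * q ^ n * (1 + q) else 1)" for n j :: nat
  have s: "s (Suc n) * (c / q ^ Suc n * (1 - q ^ Suc n) * (1 - a / b * q ^ n) * (1 - a / b' * q ^ n))
      = s n * e n" for n
  proof -
    have "1 - q ^ Suc n \<noteq> 0" using q by (simp del: power_Suc)
    moreover have "1 - a / b * q ^ n \<noteq> 0" "1 - a / b' * q ^ n \<noteq> 0"
      using den(1)[of "Suc n"] den(2)[of "Suc n"] by (simp_all add: qpoch_Suc)
    moreover have "s (Suc n) = s n * ((1 - \<Lambda> * A * q ^ n) * (1 - \<Lambda> * B * q ^ n)
        / ((1 - a / b * q ^ n) * (1 - a / b' * q ^ n) * (1 - q ^ Suc n)) * (q / c))"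
      by (simp add: s_def qpoch_Suc mult_ac)
    ultimately show ?thesis using nz by (simp add: e_def)
  qed
  show ?thesis
  proof (rule vanishes_in_basis_telescoping[where R = R and r = r and N = 2])
    fix n :: nat and x :: complex
    show "R n x = (\<Sum>j\<le>2. r n j * \<phi> (n + j) x)"
      using nz by (simp add: R_def r_def \<phi>_def newton_Suc numeral_2_eq_2 field_simps)
  next
    fix x :: complex
    show "s 0 * factored_lhs A B \<Lambda> a c b b' x (\<phi> 0 (x / q) / \<Lambda>) (\<Lambda> * \<phi> 0 (q * x)) (\<phi> 0 x) = R 0 x"
      using factored_lhs_newton_0[OF nz(2), of A B a c b b' x] by (simp add: \<phi>_def R_def e_def)
  next
    fix n :: nat and x :: complex
    have "s (Suc n) * factored_lhs A B \<Lambda> a c b b' x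
            (\<phi> (Suc n) (x / q) / \<Lambda>) (\<Lambda> * \<phi> (Suc n) (q * x)) (\<phi> (Suc n) x)
        = x ^ 2 / \<Lambda> * (s (Suc n) * e (Suc n) * \<phi> (Suc n) x
           - s (Suc n) * (c / q ^ Suc n * (1 - q ^ Suc n) * (1 - a / b * q ^ n) * (1 - a / b' * q ^ n)) * \<phi> n x)"
      unfolding \<phi>_def factored_lhs_newton_Suc[OF nz(1-5) rel] e_def by (simp add: right_diff_distrib mult_ac)
    also have "\<dots> = R (Suc n) x - R n x"
      unfolding s by (simp add: R_def right_diff_distrib)
    finally show "s (Suc n) * factored_lhs A B \<Lambda> a c b b' x
            (\<phi> (Suc n) (x / q) / \<Lambda>) (\<Lambda> * \<phi> (Suc n) (q * x)) (\<phi> (Suc n) x) = R (Suc n) x - R n x" .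
  qed
qed

text \<open>The summand n is 1/x times s n (f n \<open>\<phi> (n + 1)\<close> + g n
  \<open>\<phi> n\<close> - k (n-1) \<open>\<phi> (n - 1)\<close>), without the last term for n = 0.
  Collecting equal indices leaves the three-term relation \<open>sS\<close> for s, with
  \<open>s0\<close> as its initial case; both come from the recurrence of C.\<close>

lemma vanishes_in_newton_basis_inverse:
  fixes A B \<Lambda> a c b b' q :: complex and P :: "nat \<Rightarrow> complex"
  assumes nz: "q \<noteq> 0" "\<Lambda> \<noteq> 0" "A \<noteq> 0" "b \<noteq> 0" "b' \<noteq> 0" "c \<noteq> 0"
    and q: "\<forall>n>0. q ^ n \<noteq> 1"
    and rel: "a * c = \<Lambda> ^ 2 * A * B * q * b * b'"
    and den: "\<And>n. qpoch (c / b) q n \<noteq> 0"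
    and P: "\<And>k. P (Suc k) * ((1 - a / b * q ^ k) * (1 - q ^ Suc k))
      = - (a / (\<Lambda> * A * b')) * q ^ k * (1 - \<Lambda> * A * b' * q / c * q ^ k) * P k"
  defines "\<phi> \<equiv> \<lambda>n x. newton (1 / b) q n (1 / x)"
  defines "C \<equiv> \<lambda>n. \<Sum>k\<le>n. P k / (q ^ (n * k) * qpoch q q (n - k))"
  defines "s \<equiv> \<lambda>n. C n * (qpoch (\<Lambda> * A) q n / qpoch (c / b) q n) * (c / (\<Lambda> * A)) ^ n"
  shows "vanishes_in_basis \<phi> (\<lambda>n x. s n *
           factored_lhs A B \<Lambda> a c b b' x (A * \<phi> n (x / q)) (\<phi> n (q * x) / A) (\<phi> n x) / x ^ 2)"
proof -
  define f where "f n = B * b * b' * (1 - \<Lambda> * A * q ^ n) * (1 - \<Lambda> * A * q ^ Suc n) / q ^ n" for n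
  define \<sigma> where "\<sigma> n = (a + c) / \<Lambda> - B * b / q ^ n + \<Lambda> * A * B * b' * (1 - q ^ n * (1 + q))" for n
  define g where "g n = (1 - \<Lambda> * A * q ^ n) * \<sigma> n" for n
  define k where "k n = A * (1 - a / b * q ^ n) * (1 - c / b * q ^ n) * (1 - q ^ Suc n)" for n
  \<comment> \<open>The partial sum after \<open>sS\<close> has removed all but the two topmost
    basis functions; its second coefficient is s n g n + s (n-1) f (n-1), rewritten as s (n+1) k
    n.\<close>
  define R where "R n x = 1 / x * (s n * f n * \<phi> (Suc n) x + s (Suc n) * k n * \<phi> n x)" for n x
  define r where "r n j =
     (if j = 0 then s (Suc n) * k n * (q ^ n / b)
      else if j = 1 then s n * f n * (q ^ Suc n / b) + s (Suc n) * k n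
      else s n * f n)" for n j :: nat
  have den': "1 - c / b * q ^ n \<noteq> 0" for n
    using den[of "Suc n"] by (simp add: qpoch_Suc)
  have B: "B = a * c / (\<Lambda> ^ 2 * A * q * b * b')" using rel nz by (simp add: field_simps)
  \<comment> \<open>The recurrence is taken at u = a / b, v = \<Lambda> A b' q / c and W = a /
    (\<Lambda> A b'), so that v W = a q / c.\<close>
  have rec: "(1 - a / b * q ^ m) * (1 - q ^ Suc m) * C (Suc m)
    = \<Lambda> / c * \<sigma> m * C m + (a / c / q ^ m - a / b / q) * (if m = 0 then 0 else C (m - 1))" for m
  proof -
    have 1: "1 + \<Lambda> * A * b' * q / c * (a / (\<Lambda> * A * b')) / q - a / (\<Lambda> * A * b') / q ^ Suc m
       + a / b / q * (1 - q ^ m - q ^ Suc m) = \<Lambda> / c * \<sigma> m"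
      unfolding \<sigma>_def B using nz by (simp add: divide_simps power2_eq_square) algebra
    have 2: "\<Lambda> * A * b' * q / c * (a / (\<Lambda> * A * b')) / q ^ Suc m = a / c / q ^ m"
      using nz by simp
    show ?thesis
      using convolution_recurrence[OF nz(1) q P, of m] unfolding C_def 1 2 .
  qed
  have sk: "s (Suc n) * k n = qpoch (\<Lambda> * A) q n / qpoch (c / b) q n * (c / (\<Lambda> * A)) ^ n *
     ((1 - \<Lambda> * A * q ^ n) * c / \<Lambda> * ((1 - a / b * q ^ n) * (1 - q ^ Suc n) * C (Suc n)))" for n
    using den' nz by (simp add: s_def k_def qpoch_Suc mult_ac)
  have s0: "s 0 * g 0 = s (Suc 0) * k 0"
    unfolding sk rec using nz by (simp add: s_def g_def)
  have sS: "s n * f n + s (Suc n) * g (Suc n) = s (Suc (Suc n)) * k (Suc n)" for n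
  proof -
    \<comment> \<open>\<open>w\<close> is the part of s n other than C n, and \<open>z\<close> is
      its ratio from n to n + 1. With these split off, \<open>sS\<close> becomes \<open>rec\<close>
      at m = n + 1.\<close>
    define w where "w = qpoch (\<Lambda> * A) q n / qpoch (c / b) q n * (c / (\<Lambda> * A)) ^ n"
    define z where "z = (1 - \<Lambda> * A * q ^ n) / (1 - c / b * q ^ n) * (c / (\<Lambda> * A))"
    have w1: "qpoch (\<Lambda> * A) q (Suc n) / qpoch (c / b) q (Suc n) * (c / (\<Lambda> * A)) ^ Suc n = w * z"
      by (simp add: w_def z_def qpoch_Suc mult_ac)
    have s1: "s (Suc n) = C (Suc n) * w * z"
      by (simp only: s_def mult.assoc w1)
    have s0: "s n = C n * w" by (simp add: s_def w_def)
    have f: "f n = z * (1 - \<Lambda> * A * q ^ Suc n) * (c / \<Lambda>) * (a / c / q ^ Suc n - a / b / q)"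
      unfolding f_def z_def B using nz den'[of n]
      by (simp add: divide_simps power2_eq_square) algebra
    show ?thesis
      unfolding sk rec w1 unfolding s0 s1 f g_def using nz by (simp add: field_simps)
  qed
  show ?thesis
  proof (rule vanishes_in_basis_telescoping[where R = R and r = r and N = 2])
    fix n :: nat and x :: complex
    have y: "1 / x * \<phi> m x = \<phi> (Suc m) x + q ^ m / b * \<phi> m x" for m
      by (simp add: \<phi>_def newton_Suc algebra_simps)
    have "R n x = s n * f n * (1 / x * \<phi> (Suc n) x) + s (Suc n) * k n * (1 / x * \<phi> n x)"
      by (simp add: R_def algebra_simps add_divide_distrib)
    then show "R n x = (\<Sum>j\<le>2. r n j * \<phi> (n + j) x)"
      unfolding y by (simp add: r_def numeral_2_eq_2 algebra_simps)
  next
    fix x :: complex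
    assume x: "x \<noteq> 0"
    have "s 0 * factored_lhs A B \<Lambda> a c b b' x (A * \<phi> 0 (x / q)) (\<phi> 0 (q * x) / A) (\<phi> 0 x) / x ^ 2
       = s 0 * (factored_lhs A B \<Lambda> a c b b' x A (1 / A) 1 / x ^ 2)"
      by (simp add: \<phi>_def)
    also have "\<dots> = 1 / x * (s 0 * f 0 * \<phi> (Suc 0) x + s 0 * g 0 * \<phi> 0 x)"
      unfolding factored_lhs_newton_inverse_0[OF nz(1-4) x rel]
      by (simp add: f_def g_def \<sigma>_def \<phi>_def newton_def algebra_simps add_divide_distrib)
    finally show "s 0 * factored_lhs A B \<Lambda> a c b b' x
        (A * \<phi> 0 (x / q)) (\<phi> 0 (q * x) / A) (\<phi> 0 x) / x ^ 2 = R 0 x"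
      by (simp only: s0 R_def)
  next
    fix n :: nat and x :: complex
    assume x: "x \<noteq> 0"
    have "factored_lhs A B \<Lambda> a c b b' x
            (A * \<phi> (Suc n) (x / q)) (\<phi> (Suc n) (q * x) / A) (\<phi> (Suc n) x) / x ^ 2
        = 1 / x * (f (Suc n) * \<phi> (Suc (Suc n)) x + g (Suc n) * \<phi> (Suc n) x - k n * \<phi> n x)"
      using factored_lhs_newton_inverse_Suc[OF nz(1-4,6) x rel, of n]
      by (simp add: \<phi>_def f_def g_def \<sigma>_def k_def mult.commute[of q x])
    then have "s (Suc n) * factored_lhs A B \<Lambda> a c b b' x
            (A * \<phi> (Suc n) (x / q)) (\<phi> (Suc n) (q * x) / A) (\<phi> (Suc n) x) / x ^ 2
        = s (Suc n) * (1 / x * (f (Suc n) * \<phi> (Suc (Suc n)) x + g (Suc n) * \<phi> (Suc n) x - k n * \<phi> n x))"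
      by (metis times_divide_eq_right)
    also have "\<dots> = R (Suc n) x - R n x"
      unfolding R_def sS[symmetric] by (simp add: algebra_simps add_divide_distrib diff_divide_distrib)
    finally show "s (Suc n) * factored_lhs A B \<Lambda> a c b b' x
            (A * \<phi> (Suc n) (x / q)) (\<phi> (Suc n) (q * x) / A) (\<phi> (Suc n) x) / x ^ 2 = R (Suc n) x - R n x" .
  qed
qed

section \<open>Powers of q and the factored form of the equation\<close>

lemma qpow_add: "qpow lq (a + b) = qpow lq a * qpow lq b"
  by (simp add: qpow_def distrib_right exp_add)

lemma qpow_diff: "qpow lq (a - b) = qpow lq a / qpow lq b"
  by (simp add: qpow_def left_diff_distrib exp_diff)

lemma qpow_minus: "qpow lq (- a) = 1 / qpow lq a"
  by (simp add: qpow_def exp_minus field_simps)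

lemma qpow_1 [simp]: "qpow lq 1 = exp lq"
  by (simp add: qpow_def)

lemma qpow_nonzero [simp]: "qpow lq a \<noteq> 0"
  by (simp add: qpow_def)

lemma qpow_of_nat_mult: "qpow lq (of_nat n * a) = qpow lq a ^ n"
  by (simp add: qpow_def mult.assoc exp_of_nat_mult)

lemma qpow_half_squared: "qpow lq (1 / 2) * qpow lq (1 / 2) = exp lq"
  by (simp flip: qpow_add)

text \<open>The factor p balances the exponents: every product of p with a power of q in E and in
  the constant term is a monomial in the zeros, \<Lambda>, A and B.\<close>

lemma variant_lhs_factored:
  assumes "(i, i') \<in> {(1, 2), (2, 1)}"
  shows "variant_lhs lq h l \<alpha> t x gm gp g0 =
    factored_lhs (qpow lq (\<alpha> 1)) (qpow lq (\<alpha> 2)) (qpow lq (lam h l \<alpha>))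
      (qpow lq (h i + 1/2) * t i) (qpow lq (h i' + 1/2) * t i')
      (qpow lq (l i - 1/2) * t i) (qpow lq (l i' - 1/2) * t i') x gm gp g0"
proof -
  define p where "p = qpow lq ((h 1 + h 2 + l 1 + l 2 + \<alpha> 1 + \<alpha> 2) / 2)"
  define \<Lambda> where "\<Lambda> = qpow lq (lam h l \<alpha>)"
  define A B where "A = qpow lq (\<alpha> 1)" and "B = qpow lq (\<alpha> 2)"
  define a1 a2 where "a1 = qpow lq (h 1 + 1/2)" and "a2 = qpow lq (h 2 + 1/2)"
  define b1 b2 where "b1 = qpow lq (l 1 - 1/2)" and "b2 = qpow lq (l 2 - 1/2)"
  note defs = p_def \<Lambda>_def A_def B_def a1_def a2_def b1_def b2_def
  \<comment> \<open>Each of the six equations is a linear identity between exponents, by the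
    definition of lambda.\<close>
  have p:
    "p * qpow lq (- h 2) = a1 / \<Lambda>" "p * qpow lq (- l 2) = \<Lambda> * A * B * b1"
    "p * qpow lq (- h 1) = a2 / \<Lambda>" "p * qpow lq (- l 1) = \<Lambda> * A * B * b2"
    "p * qpow lq (1/2) = a1 * a2 / \<Lambda>" "p * qpow lq (- 1/2) = \<Lambda> * A * B * b1 * b2"
    unfolding defs qpow_add[symmetric] qpow_diff[symmetric] lam_def
    by (rule arg_cong[of _ _ "qpow lq"], simp add: field_simps)+
  have E: "- p * ((qpow lq (- h 2) + qpow lq (- l 2)) * t 1 + (qpow lq (- h 1) + qpow lq (- l 1)) * t 2)
      = - ((a1 * t 1 + a2 * t 2) / \<Lambda> + \<Lambda> * A * B * (b1 * t 1 + b2 * t 2))"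
  proof -
    have "- p * ((qpow lq (- h 2) + qpow lq (- l 2)) * t 1 + (qpow lq (- h 1) + qpow lq (- l 1)) * t 2)
      = - ((p * qpow lq (- h 2) + p * qpow lq (- l 2)) * t 1
         + (p * qpow lq (- h 1) + p * qpow lq (- l 1)) * t 2)"
      by (simp add: algebra_simps)
    then show ?thesis unfolding p by (simp add: add_divide_distrib algebra_simps)
  qed
  have "p * (qpow lq (1/2) + qpow lq (- 1/2)) * t 1 * t 2
      = (p * qpow lq (1/2) + p * qpow lq (- 1/2)) * t 1 * t 2"
    by (simp only: distrib_left)
  then have C: "p * (qpow lq (1/2) + qpow lq (- 1/2)) * t 1 * t 2
      = a1 * t 1 * (a2 * t 2) / \<Lambda> + \<Lambda> * A * B * (b1 * t 1) * (b2 * t 2)"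
    unfolding p by (simp add: algebra_simps)
  have "variant_lhs lq h l \<alpha> t x gm gp g0
      = factored_lhs A B \<Lambda> (a1 * t 1) (a2 * t 2) (b1 * t 1) (b2 * t 2) x gm gp g0"
    unfolding variant_lhs_def Let_def p_def[symmetric] E C factored_lhs_def qpow_add[of lq "\<alpha> 1"]
      A_def[symmetric] B_def[symmetric] a1_def[symmetric] a2_def[symmetric]
      b1_def[symmetric] b2_def[symmetric]
    by (simp add: algebra_simps)
  \<comment> \<open>Swapping a with c and b with b' simultaneously covers the case (i, i') = (2,
    1).\<close>
  moreover have "factored_lhs A B \<Lambda> (a1 * t 1) (a2 * t 2) (b1 * t 1) (b2 * t 2) x gm gp g0
      = factored_lhs A B \<Lambda> (a2 * t 2) (a1 * t 1) (b2 * t 2) (b1 * t 1) x gm gp g0"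
    by (simp add: factored_lhs_def mult_ac add_ac)
  ultimately show ?thesis
    using assms by (auto simp: A_def B_def \<Lambda>_def a1_def a2_def b1_def b2_def)
qed

text \<open>This is the definition of lambda in exponential form: h_1 + h_2 + 1 = 2 lambda +
  \<alpha>_1 + \<alpha>_2 + l_1 + l_2.\<close>

lemma qpow_lam_relation:
  assumes "(i, i') \<in> {(1, 2), (2, 1)}"
  shows "(qpow lq (h i + 1/2) * t i) * (qpow lq (h i' + 1/2) * t i')
    = qpow lq (lam h l \<alpha>) ^ 2 * qpow lq (\<alpha> 1) * qpow lq (\<alpha> 2) * exp lq
      * (qpow lq (l i - 1/2) * t i) * (qpow lq (l i' - 1/2) * t i')"
proof -
  have "qpow lq (h i + 1/2) * qpow lq (h i' + 1/2)
    = qpow lq (lam h l \<alpha>) * qpow lq (lam h l \<alpha>) * qpow lq (\<alpha> 1) * qpow lq (\<alpha> 2) * qpow lq 1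
      * qpow lq (l i - 1/2) * qpow lq (l i' - 1/2)"
    unfolding qpow_add[symmetric] lam_def using assms
    by (intro arg_cong[of _ _ "qpow lq"]) (auto simp: field_simps)
  then show ?thesis by (simp add: power2_eq_square mult_ac)
qed

lemma vanishes_in_basis_cong:
  assumes "\<And>n x. x \<noteq> 0 \<Longrightarrow> \<phi> n x = \<psi> n x" and "\<And>n x. x \<noteq> 0 \<Longrightarrow> T n x = S n x"
  shows "vanishes_in_basis \<phi> T \<longleftrightarrow> vanishes_in_basis \<psi> S"
  unfolding vanishes_in_basis_def using assms by simp

section \<open>The two formal solutions in the original parameters\<close>

theorem theorem2p2:
  fixes q lq :: complex and h l \<alpha> t :: "nat \<Rightarrow> complex" and i i' :: nat
  assumes "q \<noteq> 0" and "exp lq = q" and "\<forall>n>0. q ^ n \<noteq> 1"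
    and "t 1 \<noteq> 0" and "t 2 \<noteq> 0"
    and "(i, i') \<in> {(1, 2), (2, 1)}"
  shows
    "((\<forall>n. qpoch (qpow lq (h i - l i + 1)) q n \<noteq> 0) \<and>
      (\<forall>n. qpoch (qpow lq (h i - l i' + 1) * t i / t i') q n \<noteq> 0) \<longrightarrow>
      (let \<Lambda> = lam h l \<alpha>;
           u = (\<lambda>n x. qpoch (qpow lq (\<Lambda> + \<alpha> 1)) q n * qpoch (qpow lq (\<Lambda> + \<alpha> 2)) q n
                  / (qpoch (qpow lq (h i - l i + 1)) q n
                     * qpoch (qpow lq (h i - l i' + 1) * t i / t i') q n * qpoch q q n)
                  * qpoch (qpow lq (h i + 1/2) * t i / x) q n
                  * (x / (qpow lq (h i' - 1/2) * t i')) ^ n)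
       in formal_solution lq (variant_lhs lq h l \<alpha> t) \<Lambda>
            (\<lambda>n x. qpoch (qpow lq (h i + 1/2) * t i / x) q n * x ^ n) u \<and>
          (\<forall>n x. x \<noteq> 0 \<longrightarrow>
             u n x = bhs_summand
               [qpow lq (\<Lambda> + \<alpha> 1), qpow lq (\<Lambda> + \<alpha> 2), qpow lq (h i + 1/2) * t i / x]
               [qpow lq (h i - l i + 1), qpow lq (h i - l i' + 1) * t i / t i']
               q (x / (qpow lq (h i' - 1/2) * t i')) n)))
     \<and>
     ((\<forall>n. qpoch (qpow lq (1 + h i' - l i) * t i' / t i) q n \<noteq> 0) \<and>
      (\<forall>n. qpoch (qpow lq (h i - l i + 1)) q n \<noteq> 0) \<longrightarrow>
      (let \<Lambda> = lam h l \<alpha>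
       in formal_solution lq (variant_lhs lq h l \<alpha> t) (- \<alpha> 1)
            (\<lambda>n x. qpoch (x / (qpow lq (l i - 1/2) * t i)) q n / x ^ n)
            (\<lambda>n x. c_coeff lq h l \<alpha> t i i' n
                  * (qpoch (qpow lq (\<Lambda> + \<alpha> 1)) q n
                     / qpoch (qpow lq (1 + h i' - l i) * t i' / t i) q n)
                  * qpoch (x / (qpow lq (l i - 1/2) * t i)) q n
                  * (qpow lq (- \<Lambda> - \<alpha> 1 + h i' + 1/2) * t i' / x) ^ n)))"
    (is "(?den1 \<longrightarrow> ?concl1) \<and> (?den2 \<longrightarrow> ?concl2)")
proof -
  define A B \<Lambda> where "A = qpow lq (\<alpha> 1)" and "B = qpow lq (\<alpha> 2)" and "\<Lambda> = qpow lq (lam h l \<alpha>)"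
  define a c where "a = qpow lq (h i + 1/2) * t i" and "c = qpow lq (h i' + 1/2) * t i'"
  define b b' where "b = qpow lq (l i - 1/2) * t i" and "b' = qpow lq (l i' - 1/2) * t i'"
  note defs = A_def B_def \<Lambda>_def a_def c_def b_def b'_def
  have t: "t i \<noteq> 0" "t i' \<noteq> 0" using assms by auto
  have nz: "A \<noteq> 0" "B \<noteq> 0" "\<Lambda> \<noteq> 0" "a \<noteq> 0" "c \<noteq> 0" "b \<noteq> 0" "b' \<noteq> 0"
    using t by (simp_all add: defs)
  \<comment> \<open>A square root of q consistent with the chosen logarithm; all half-integral
    exponents are expressed through it.\<close>
  define r where "r = qpow lq (1 / 2)"
  have r: "r * r = q" "r \<noteq> 0"
    using qpow_half_squared assms(2) by (simp_all add: r_def)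
  have q: "q = qpow lq 1" using assms(2) by simp
  have L: "variant_lhs lq h l \<alpha> t = factored_lhs A B \<Lambda> a c b b'"
    unfolding defs by (intro ext variant_lhs_factored[OF assms(6)])
  have rel: "a * c = \<Lambda> ^ 2 * A * B * q * b * b'"
    using qpow_lam_relation[OF assms(6), of lq h t l \<alpha>] unfolding assms(2) defs .
  have upper: "qpow lq (lam h l \<alpha> + \<alpha> 1) = \<Lambda> * A" "qpow lq (lam h l \<alpha> + \<alpha> 2) = \<Lambda> * B"
    by (simp_all add: defs qpow_add)
  note qpows = qpow_add qpow_diff qpow_minus r_def[symmetric]
  have lower: "qpow lq (h i - l i + 1) = a / b" "qpow lq (h i - l i' + 1) * t i / t i' = a / b'"
    "qpow lq (1 + h i' - l i) * t i' / t i = c / b"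
    using t r assms(2) by (simp_all add: defs qpows)
  have arg1: "qpow lq (h i' - 1/2) * t i' = c / q"
    using t r by (simp add: defs qpows flip: r(1))
  have arg2: "qpow lq (- lam h l \<alpha> - \<alpha> 1 + h i' + 1/2) * t i' = c / (\<Lambda> * A)"
    by (simp add: defs qpows)
  show ?thesis
  proof (intro conjI impI)
    assume den: ?den1
    define s where "s n = qpoch (\<Lambda> * A) q n * qpoch (\<Lambda> * B) q n
      / (qpoch (a / b) q n * qpoch (a / b') q n * qpoch q q n) * (q / c) ^ n" for n
    define u where "u n x = qpoch (\<Lambda> * A) q n * qpoch (\<Lambda> * B) q n
      / (qpoch (a / b) q n * qpoch (a / b') q n * qpoch q q n) * qpoch (a / x) q n * (x / (c / q)) ^ n"
      for n x
    have u: "u n x = s n * newton a q n x" if "x \<noteq> 0" for n x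
      using that nz assms(1)
      by (simp add: u_def s_def flip: qpoch_eq_newton) (simp add: power_divide power_mult_distrib)
    have "vanishes_in_basis (newton a q) (\<lambda>n x. s n * factored_lhs A B \<Lambda> a c b b' x
             (newton a q n (x / q) / \<Lambda>) (\<Lambda> * newton a q n (q * x)) (newton a q n x))"
      unfolding s_def using den lower
      by (intro vanishes_in_newton_basis assms nz rel) simp_all
    also have "?this \<longleftrightarrow> vanishes_in_basis (\<lambda>n x. qpoch (a / x) q n * x ^ n)
        (\<lambda>n x. reduced_lhs lq (variant_lhs lq h l \<alpha> t) (lam h l \<alpha>) (u n) x)"
    proof (rule vanishes_in_basis_cong)
      fix n :: nat and x :: complex
      assume x: "x \<noteq> 0"
      show "newton a q n x = qpoch (a / x) q n * x ^ n" by (simp add: x qpoch_eq_newton)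
      show "s n * factored_lhs A B \<Lambda> a c b b' x
             (newton a q n (x / q) / \<Lambda>) (\<Lambda> * newton a q n (q * x)) (newton a q n x)
          = reduced_lhs lq (variant_lhs lq h l \<alpha> t) (lam h l \<alpha>) (u n) x"
        using x assms(1) unfolding factored_lhs_scale[symmetric]
        by (simp add: reduced_lhs_def L u assms(2) qpow_minus mult_ac flip: \<Lambda>_def)
    qed
    finally have "vanishes_in_basis (\<lambda>n x. qpoch (a / x) q n * x ^ n)
        (\<lambda>n x. reduced_lhs lq (variant_lhs lq h l \<alpha> t) (lam h l \<alpha>) (u n) x)" .
    moreover have "poly_basis_x (\<lambda>n x. qpoch (a / x) q n * x ^ n)"
      unfolding poly_basis_x_def using newton_eq_poly[of _ a q] by (simp add: qpoch_eq_newton) blast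
    moreover have "\<exists>s. \<forall>n x. x \<noteq> 0 \<longrightarrow> u n x = s n * (qpoch (a / x) q n * x ^ n)"
      using u by (auto simp: qpoch_eq_newton)
    ultimately have sol: "formal_solution lq (variant_lhs lq h l \<alpha> t) (lam h l \<alpha>)
        (\<lambda>n x. qpoch (a / x) q n * x ^ n) u"
      unfolding formal_solution_def by blast
    \<comment> \<open>For three upper and two lower parameters the exponent 1 + s - r of the sign
      and q-power factor is 0.\<close>
    show ?concl1
      unfolding upper lower arg1 a_def[symmetric] Let_def u_def[symmetric]
      by (intro conjI allI impI sol) (simp add: u_def bhs_summand_def mult_ac)
  next
    assume den: ?den2
    define w where "w = qpow lq (- lam h l \<alpha> - \<alpha> 1 + h i + 1/2) * t i / (qpow lq (l i') * t i')"
    \<comment> \<open>The summand of c_n without its n-dependent factors q^(-nk) and 1 /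
      (q;q)_(n-k); here r^(k^2) is q^(k^2/2).\<close>
    define P where "P k = r ^ (k * k) * (qpoch (\<Lambda> * A * b' * q / c) q k
        / (qpoch (a / b) q k * qpoch q q k)) * (- w) ^ k" for k
    define C where "C n = (\<Sum>k\<le>n. P k / (q ^ (n * k) * qpoch q q (n - k)))" for n
    \<comment> \<open>From k to k + 1 the power r^(k^2) gains r q^k; its r joins w to form the W of
      the recurrence.\<close>
    have w: "r * w = a / (\<Lambda> * A * b')"
      using t r(2) by (simp add: w_def defs qpows)
    have v: "qpow lq (lam h l \<alpha> + \<alpha> 1 - h i' + l i') = \<Lambda> * A * b' * q / c"
      using t r(2) by (simp add: defs qpows flip: r(1))
    have C: "c_coeff lq h l \<alpha> t i i' n = C n" for n
    proof -
      have "qpow lq (- of_nat n * of_nat k + of_nat k ^ 2 / 2) = r ^ (k * k) / q ^ (n * k)" for k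
      proof -
        have "qpow lq (- of_nat n * of_nat k + of_nat k ^ 2 / 2)
            = qpow lq (of_nat (k * k) * (1 / 2) - of_nat (n * k) * 1)"
          by (simp add: power2_eq_square)
        also have "\<dots> = r ^ (k * k) / q ^ (n * k)"
          unfolding qpow_diff qpow_of_nat_mult r_def q ..
        finally show ?thesis .
      qed
      then show ?thesis
        unfolding c_coeff_def Let_def assms(2) v lower w_def[symmetric] C_def P_def
        by (simp add: mult_ac)
    qed
    have qk: "1 - q ^ Suc k \<noteq> 0" for k using assms(3) by (simp del: power_Suc)
    have P: "P (Suc k) * ((1 - a / b * q ^ k) * (1 - q ^ Suc k))
      = - (a / (\<Lambda> * A * b')) * q ^ k * (1 - \<Lambda> * A * b' * q / c * q ^ k) * P k" for k
    proof -
      have "1 - a / b * q ^ k \<noteq> 0"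
        using den[unfolded lower, THEN conjunct2, rule_format, of "Suc k"] by (simp add: qpoch_Suc)
      moreover have "r ^ (Suc k * Suc k) = r ^ (k * k) * (r * q ^ k)"
        by (simp add: power_add power_mult_distrib flip: r(1))
      moreover have "qpoch q q (Suc k) = qpoch q q k * (1 - q ^ Suc k)" by (simp add: qpoch_Suc)
      ultimately show ?thesis
        unfolding w[symmetric] using qk[of k] nz
        by (simp add: P_def qpoch_Suc del: power_Suc mult_Suc mult_Suc_right) (simp add: mult_ac)
    qed
    define s where "s n = C n * (qpoch (\<Lambda> * A) q n / qpoch (c / b) q n) * (c / (\<Lambda> * A)) ^ n" for n
    define u where "u n x = C n * (qpoch (\<Lambda> * A) q n / qpoch (c / b) q n)
        * qpoch (x / b) q n * (c / (\<Lambda> * A) / x) ^ n" for n x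
    have u: "u n x = s n * newton (1 / b) q n (1 / x)" if "x \<noteq> 0" for n x
      using that nz by (simp add: u_def s_def power_divide power_mult_distrib mult_ac flip: qpoch_eq_newton_inverse)
    have "vanishes_in_basis (\<lambda>n x. newton (1 / b) q n (1 / x)) (\<lambda>n x. s n *
           factored_lhs A B \<Lambda> a c b b' x (A * newton (1 / b) q n (1 / (x / q)))
             (newton (1 / b) q n (1 / (q * x)) / A) (newton (1 / b) q n (1 / x)) / x ^ 2)"
      unfolding s_def C_def using den lower
      by (intro vanishes_in_newton_basis_inverse assms nz rel P) simp_all
    also have "?this \<longleftrightarrow> vanishes_in_basis (\<lambda>n x. qpoch (x / b) q n / x ^ n)
        (\<lambda>n x. reduced_lhs lq (variant_lhs lq h l \<alpha> t) (- \<alpha> 1) (u n) x / x ^ 2)"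
    proof (rule vanishes_in_basis_cong)
      fix n :: nat and x :: complex
      assume x: "x \<noteq> 0"
      show "newton (1 / b) q n (1 / x) = qpoch (x / b) q n / x ^ n"
        by (simp add: x nz qpoch_eq_newton_inverse)
      show "s n * factored_lhs A B \<Lambda> a c b b' x (A * newton (1 / b) q n (1 / (x / q)))
             (newton (1 / b) q n (1 / (q * x)) / A) (newton (1 / b) q n (1 / x)) / x ^ 2
          = reduced_lhs lq (variant_lhs lq h l \<alpha> t) (- \<alpha> 1) (u n) x / x ^ 2"
        using x assms(1) unfolding factored_lhs_scale[symmetric]
        by (simp add: reduced_lhs_def L u assms(2) qpow_minus mult_ac A_def)
    qed
    finally have "vanishes_in_basis (\<lambda>n x. qpoch (x / b) q n / x ^ n)
        (\<lambda>n x. reduced_lhs lq (variant_lhs lq h l \<alpha> t) (- \<alpha> 1) (u n) x / x ^ 2)" .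
    moreover have "poly_basis_inverse_x (\<lambda>n x. qpoch (x / b) q n / x ^ n)"
      unfolding poly_basis_inverse_x_def using newton_eq_poly[of _ "1 / b" q] nz
      by (simp add: qpoch_eq_newton_inverse) blast
    moreover have "\<exists>s. \<forall>n x. x \<noteq> 0 \<longrightarrow> u n x = s n * (qpoch (x / b) q n / x ^ n)"
      using u nz by (auto simp: qpoch_eq_newton_inverse)
    ultimately show ?concl2
      unfolding upper lower arg2 b_def[symmetric] Let_def C u_def[symmetric] formal_solution_def
      by simp
  qed
qed

end
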